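(* Let $V$ be a finite-dimensional vector space over a field $\mathbf{k}$ of characteristic zero. There is a bijective correspondence between double Lie brackets $\{\!\{\cdot,\cdot\}\!\}:V\otimes V\to V\otimes V$ on $V$ and Maurer-Cartan elements $\mu\in\mathcal{C}^1_{dL}(V)$ of the graded Lie algebra $(\mathcal{C}^\bullet_{dL}(V),[\cdot,\cdot]_{dL})$. Explicitly, the correspondence is given by $\{\!\{a,b\}\!\}=\mu(a,b)$ for $a,b\in V$, and the Maurer-Cartan equation is equivalently $[\mu,\mu]_{dL}=0$.
   Context: For $n\ge1$, $\sigma_n:V^{\otimes n}\to V^{\otimes n}$ is $\sigma_n(a_1\otimes\cdots\otimes a_n)=a_n\otimes a_1\otimes\cdots\otimes a_{n-1}$, and $x^{\sigma}:=\sigma_n(x)$ for $x\in V^{\otimes n}$. A double Lie bracket on $V$ is a linear map $\{\!\{\cdot,\cdot\}\!\}:V\otimes V\to V\otimes V$ such that, for all $a,b,c\in V$: (skew-symmetry) $\{\!\{a,b\}\!\}=-\{\!\{b,a\}\!\}^{\sigma}$; (Jacobi identity) $\{\!\{a,\{\!\{b,c\}\!\}\}\!\}_L+\{\!\{b,\{\!\{c,a\}\!\}\}\!\}_L^{\sigma}+\{\!\{c,\{\!\{a,b\}\!\}\}\!\}_L^{\sigma^2}=0$, where $\{\!\{a,b\otimes c\}\!\}_L:=\{\!\{a,b\}\!\}\otimes c$ (extended linearly). For $p\ge0$, $\mathcal{C}^p_{dL}(V):=\{P\in\mathrm{End}(V^{\otimes(p+1)})\mid \sigma_{p+1}P\sigma_{p+1}^{-1}=(-1)^pP\}$,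 of degree $p$. For $P\in\mathcal{C}^p_{dL}(V)$, $Q\in\mathcal{C}^q_{dL}(V)$: $P\diamond Q:=(P\otimes\mathrm{id}^{\otimes q})\circ(\mathrm{id}^{\otimes p}\otimes Q)$, $P\,\square\, Q:=\sum_{s=0}^{p+q}(-1)^{(p+q)s}\sigma_{p+q+1}^{s}\circ(P\diamond Q)\circ\sigma_{p+q+1}^{-s}$, and $[P,Q]_{dL}:=P\,\square\, Q-(-1)^{pq}Q\,\square\, P$. This makes $\mathcal{C}^\bullet_{dL}(V)=\bigoplus_{p\ge0}\mathcal{C}^p_{dL}(V)$ a graded Lie algebra. A Maurer-Cartan element of a dg Lie algebra $(\mathfrak g,[\cdot,\cdot],d)$ is $x\in\mathfrak g^1$ with $dx+\frac12[x,x]=0$; a graded Lie algebra is regarded as a dg Lie algebra with $d=0$. *)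

theory Defs
  imports Complex_Main "HOL-Library.Function_Algebras"
begin

section \<open>Tensor powers\<close>

text \<open>
  A vector space \<open>V\<close> over a field is a type \<open>'v\<close> together with a scalar multiplication
  \<open>scale\<close>. The tensor power \<open>V\<^sup>\<otimes>\<^sup>n\<close> is realised inside the functions on lists of linear functionals:
  \<open>a\<^sub>1 \<otimes> \<dots> \<otimes> a\<^sub>n\<close> is the function sending a list \<open>[f\<^sub>1, \<dots>, f\<^sub>n]\<close> of linear functionals to
  \<open>f\<^sub>1 a\<^sub>1 \<cdots> f\<^sub>n a\<^sub>n\<close> (and every other list to \<open>0\<close>), and \<open>V\<^sup>\<otimes>\<^sup>n\<close> is the span of these pure tensors.
  Lemma \<open>tensor_power_universal\<close> below is the universal property. Since all tensor powers live in
  one type, operators between them can be composed without coercions.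
\<close>

type_synonym ('k, 'v) tensor = "('v \<Rightarrow> 'k) list \<Rightarrow> 'k"

definition tscale :: "'k::field \<Rightarrow> ('k, 'v) tensor \<Rightarrow> ('k, 'v) tensor" where
  "tscale c x = (\<lambda>fs. c * x fs)"

definition pure :: "('k::field \<Rightarrow> 'v::ab_group_add \<Rightarrow> 'v) \<Rightarrow> 'v list \<Rightarrow> ('k, 'v) tensor" where
  "pure scale as = (\<lambda>fs.
     if length fs = length as \<and> (\<forall>f\<in>set fs. Vector_Spaces.linear scale (*) f)
     then (\<Prod>i<length as. (fs ! i) (as ! i)) else 0)"

definition tensor_power ::
    "('k::field \<Rightarrow> 'v::ab_group_add \<Rightarrow> 'v) \<Rightarrow> nat \<Rightarrow> ('k, 'v) tensor set" where
  "tensor_power scale n = module.span tscale (pure scale ` {as. length as = n})"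

text \<open>
  The product \<open>V\<^sup>\<otimes>\<^sup>m \<times> V\<^sup>\<otimes>\<^sup>n \<rightarrow> V\<^sup>\<otimes>\<^sup>(\<^sup>m\<^sup>+\<^sup>n\<^sup>)\<close>; the parameter \<open>m\<close> says where to split the list of functionals.
\<close>

definition tprod :: "nat \<Rightarrow> ('k::field, 'v) tensor \<Rightarrow> ('k, 'v) tensor \<Rightarrow> ('k, 'v) tensor" where
  "tprod m x y = (\<lambda>fs. x (take m fs) * y (drop m fs))"

text \<open>
  Elements of \<open>End(V\<^sup>\<otimes>\<^sup>n)\<close> are extended by \<open>0\<close> outside \<open>V\<^sup>\<otimes>\<^sup>n\<close>, so that distinct functions are distinct
  endomorphisms and the pointwise operations on functions are those of \<open>End(V\<^sup>\<otimes>\<^sup>n)\<close>.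
\<close>

type_synonym ('k, 'v) operator = "('k, 'v) tensor \<Rightarrow> ('k, 'v) tensor"

definition oscale :: "'k::field \<Rightarrow> ('k, 'v) operator \<Rightarrow> ('k, 'v) operator" where
  "oscale c P = (\<lambda>x. tscale c (P x))"

definition tensor_End ::
    "('k::field \<Rightarrow> 'v::ab_group_add \<Rightarrow> 'v) \<Rightarrow> nat \<Rightarrow> ('k, 'v) operator set" where
  "tensor_End scale n = {P.
     (\<forall>x\<in>tensor_power scale n. P x \<in> tensor_power scale n) \<and>
     (\<forall>x\<in>tensor_power scale n. \<forall>y\<in>tensor_power scale n. P (x + y) = P x + P y) \<and>
     (\<forall>c. \<forall>x\<in>tensor_power scale n. P (tscale c x) = tscale c (P x)) \<and>
     (\<forall>x. x \<notin> tensor_power scale n \<longrightarrow> P x = 0)}"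

definition tensor_id ::
    "('k::field \<Rightarrow> 'v::ab_group_add \<Rightarrow> 'v) \<Rightarrow> nat \<Rightarrow> ('k, 'v) operator" where
  "tensor_id scale n = (\<lambda>x. if x \<in> tensor_power scale n then x else 0)"

text \<open>
  For \<open>P \<in> End(V\<^sup>\<otimes>\<^sup>m)\<close> and \<open>Q \<in> End(V\<^sup>\<otimes>\<^sup>n)\<close>, the operator \<open>P \<otimes> Q \<in> End(V\<^sup>\<otimes>\<^sup>(\<^sup>m\<^sup>+\<^sup>n\<^sup>))\<close>: \<open>Q\<close> is applied to the
  slices \<open>x (gs @ _)\<close> and \<open>P\<close> to what results in the first \<open>m\<close> arguments. It is determined by
  \<open>(P \<otimes> Q) (x \<otimes> y) = P x \<otimes> Q y\<close>, see \<open>tensor_op_unique\<close> below.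
\<close>

definition tensor_op ::
    "('k::field \<Rightarrow> 'v::ab_group_add \<Rightarrow> 'v) \<Rightarrow> nat \<Rightarrow> nat \<Rightarrow> ('k, 'v) operator \<Rightarrow> ('k, 'v) operator
      \<Rightarrow> ('k, 'v) operator" where
  "tensor_op scale m n P Q = (\<lambda>x. if x \<in> tensor_power scale (m + n)
     then (\<lambda>fs. P (\<lambda>gs. Q (\<lambda>hs. x (gs @ hs)) (drop m fs)) (take m fs)) else 0)"

text \<open>
  \<open>\<sigma>\<close> is a bijection of the whole tensor type, and it restricts to \<open>\<sigma>\<^sub>n\<close> on \<open>V\<^sup>\<otimes>\<^sup>n\<close> for every \<open>n \<ge> 1\<close>;
  see \<open>sigma_pure\<close> and \<open>bij_sigma\<close> below.
\<close>

definition sigma :: "('k, 'v) tensor \<Rightarrow> ('k, 'v) tensor" where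
  "sigma x = (\<lambda>fs. x (rotate1 fs))"


section \<open>Double Lie brackets\<close>

text \<open>The map \<open>x \<mapsto> {{a, x}}\<^sub>L\<close> is the linear map \<open>x \<mapsto> ({{_,_}} \<otimes> id\<^sub>V) (a \<otimes> x)\<close>; see \<open>bracket_L_pure\<close>.\<close>

definition bracket_L ::
    "('k::field \<Rightarrow> 'v::ab_group_add \<Rightarrow> 'v) \<Rightarrow> ('k, 'v) operator \<Rightarrow> 'v \<Rightarrow> ('k, 'v) tensor
      \<Rightarrow> ('k, 'v) tensor" where
  "bracket_L scale br a x =
     tensor_op scale 2 1 br (tensor_id scale 1) (tprod 1 (pure scale [a]) x)"

definition double_lie_bracket ::
    "('k::field \<Rightarrow> 'v::ab_group_add \<Rightarrow> 'v) \<Rightarrow> ('k, 'v) operator \<Rightarrow> bool" where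
  "double_lie_bracket scale br \<longleftrightarrow>
     br \<in> tensor_End scale 2 \<and>
     (\<forall>a b. br (pure scale [a, b]) = - sigma (br (pure scale [b, a]))) \<and>
     (\<forall>a b c.
        bracket_L scale br a (br (pure scale [b, c])) +
        sigma (bracket_L scale br b (br (pure scale [c, a]))) +
        (sigma ^^ 2) (bracket_L scale br c (br (pure scale [a, b]))) = 0)"


section \<open>The graded Lie algebra\<close>

definition C_dL ::
    "('k::field \<Rightarrow> 'v::ab_group_add \<Rightarrow> 'v) \<Rightarrow> nat \<Rightarrow> ('k, 'v) operator set" where
  "C_dL scale p =
     {P \<in> tensor_End scale (p + 1). sigma \<circ> P \<circ> inv sigma = oscale ((-1) ^ p) P}"

definition diamond ::
    "('k::field \<Rightarrow> 'v::ab_group_add \<Rightarrow> 'v) \<Rightarrow> nat \<Rightarrow> nat \<Rightarrow> ('k, 'v) operator \<Rightarrow> ('k, 'v) operator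
      \<Rightarrow> ('k, 'v) operator" where
  "diamond scale p q P Q =
     tensor_op scale (p + 1) q P (tensor_id scale q) \<circ> tensor_op scale p (q + 1) (tensor_id scale p) Q"

definition square_dL ::
    "('k::field \<Rightarrow> 'v::ab_group_add \<Rightarrow> 'v) \<Rightarrow> nat \<Rightarrow> nat \<Rightarrow> ('k, 'v) operator \<Rightarrow> ('k, 'v) operator
      \<Rightarrow> ('k, 'v) operator" where
  "square_dL scale p q P Q = (\<Sum>s=0..p + q.
     oscale ((-1) ^ ((p + q) * s)) ((sigma ^^ s) \<circ> diamond scale p q P Q \<circ> (inv sigma ^^ s)))"

definition bracket_dL ::
    "('k::field \<Rightarrow> 'v::ab_group_add \<Rightarrow> 'v) \<Rightarrow> nat \<Rightarrow> nat \<Rightarrow> ('k, 'v) operator \<Rightarrow> ('k, 'v) operator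
      \<Rightarrow> ('k, 'v) operator" where
  "bracket_dL scale p q P Q =
     square_dL scale p q P Q - oscale ((-1) ^ (p * q)) (square_dL scale q p Q P)"

text \<open>
  A dg Lie algebra is given by its homogeneous components \<open>\<gg> p\<close>, the brackets
  \<open>br p q : \<gg> p \<times> \<gg> q \<rightarrow> \<gg> (p + q)\<close> and the differentials \<open>d p : \<gg> p \<rightarrow> \<gg> (p + 1)\<close>.
\<close>

definition maurer_cartan ::
    "('k::field \<Rightarrow> 'x::ab_group_add \<Rightarrow> 'x) \<Rightarrow> (nat \<Rightarrow> 'x set) \<Rightarrow> (nat \<Rightarrow> nat \<Rightarrow> 'x \<Rightarrow> 'x \<Rightarrow> 'x)
      \<Rightarrow> (nat \<Rightarrow> 'x \<Rightarrow> 'x) \<Rightarrow> 'x \<Rightarrow> bool" where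
  "maurer_cartan s \<gg> br d x \<longleftrightarrow> x \<in> \<gg> 1 \<and> d 1 x + s (1 / 2) (br 1 1 x x) = 0"

definition maurer_cartan_dL ::
    "('k::field \<Rightarrow> 'v::ab_group_add \<Rightarrow> 'v) \<Rightarrow> ('k, 'v) operator \<Rightarrow> bool" where
  "maurer_cartan_dL scale \<mu> \<longleftrightarrow>
     maurer_cartan oscale (C_dL scale) (bracket_dL scale) (\<lambda>_ _. 0) \<mu>"


section \<open>The constructions have the expected properties\<close>

lemma vector_space_tscale: "vector_space tscale"
  by unfold_locales (auto simp: tscale_def fun_eq_iff algebra_simps)

lemma module_tscale: "module tscale"
  using vector_space_tscale by (simp add: module_iff_vector_space)

lemma pure_in_tensor_power: "pure scale as \<in> tensor_power scale (length as)"
  unfolding tensor_power_def by (rule module.span_base[OF module_tscale]) auto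

lemma tensor_power_induct [consumes 1, case_names zero add]:
  assumes "x \<in> tensor_power scale n"
    and "Q 0"
    and "\<And>c as y. length as = n \<Longrightarrow> y \<in> tensor_power scale n \<Longrightarrow> Q y
           \<Longrightarrow> Q (tscale c (pure scale as) + y)"
  shows "Q x"
proof -
  have "x \<in> tensor_power scale n \<and> Q x"
    using assms(1)[unfolded tensor_power_def]
  proof (induction rule: module.span_induct_alt[OF module_tscale, consumes 1, case_names base step])
    case base
    show "0 \<in> tensor_power scale n \<and> Q 0"
      using assms(2) module.span_zero[OF module_tscale] by (simp add: tensor_power_def)
  next
    case (step c a y)
    then obtain as where as: "a = pure scale as" "length as = n" by auto
    have "tscale c a + y \<in> tensor_power scale n"
      using step as pure_in_tensor_power[of scale as] unfolding tensor_power_def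
      by (intro module.span_add[OF module_tscale] module.span_scale[OF module_tscale]) auto
    then show "tscale c a + y \<in> tensor_power scale n \<and> Q (tscale c a + y)"
      using step assms(3) as by auto
  qed
  then show ?thesis ..
qed

lemma tensor_power_zero: "0 \<in> tensor_power scale n"
  unfolding tensor_power_def by (rule module.span_zero[OF module_tscale])

lemma tensor_power_add:
  "x \<in> tensor_power scale n \<Longrightarrow> y \<in> tensor_power scale n \<Longrightarrow> x + y \<in> tensor_power scale n"
  unfolding tensor_power_def by (rule module.span_add[OF module_tscale])

lemma tensor_power_scale:
  "x \<in> tensor_power scale n \<Longrightarrow> tscale c x \<in> tensor_power scale n"
  unfolding tensor_power_def by (rule module.span_scale[OF module_tscale])

lemma tensor_power_length:
  "x \<in> tensor_power scale n \<Longrightarrow> length fs \<noteq> n \<Longrightarrow> x fs = 0"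
  by (induction rule: tensor_power_induct) (auto simp: pure_def tscale_def)

lemma tensor_EndD:
  assumes "P \<in> tensor_End scale n"
  shows "x \<in> tensor_power scale n \<Longrightarrow> P x \<in> tensor_power scale n"
    and "x \<in> tensor_power scale n \<Longrightarrow> y \<in> tensor_power scale n \<Longrightarrow> P (x + y) = P x + P y"
    and "x \<in> tensor_power scale n \<Longrightarrow> P (tscale c x) = tscale c (P x)"
    and "x \<notin> tensor_power scale n \<Longrightarrow> P x = 0"
  using assms by (auto simp: tensor_End_def)

lemma tensor_End_zero:
  assumes "P \<in> tensor_End scale n" shows "P 0 = 0"
  using tensor_EndD(2)[OF assms tensor_power_zero tensor_power_zero] by simp

lemma tensor_id_End: "tensor_id scale n \<in> tensor_End scale n"
  by (auto simp: tensor_End_def tensor_id_def tensor_power_add tensor_power_scale)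

lemma pure_append:
  "tprod (length as) (pure scale as) (pure scale bs) = pure scale (as @ bs)"
proof
  fix fs
  show "tprod (length as) (pure scale as) (pure scale bs) fs = pure scale (as @ bs) fs"
  proof (cases "length fs = length as + length bs")
    case False
    then show ?thesis by (auto simp: tprod_def pure_def min_def)
  next
    case True
    define gs hs where "gs = take (length as) fs" and "hs = drop (length as) fs"
    have *: "fs = gs @ hs" "length gs = length as" "length hs = length bs"
      using True by (auto simp: gs_def hs_def)
    have "(\<Prod>i<length as + length bs. ((gs @ hs) ! i) ((as @ bs) ! i)) =
        (\<Prod>i<length as. (gs ! i) (as ! i)) * (\<Prod>i<length bs. (hs ! i) (bs ! i))"
    proof -
      have "(\<Prod>i<length as + length bs. ((gs @ hs) ! i) ((as @ bs) ! i)) =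
         (\<Prod>i<length as. ((gs @ hs) ! i) ((as @ bs) ! i)) *
         (\<Prod>i=length as..<length as + length bs. ((gs @ hs) ! i) ((as @ bs) ! i))"
        by (simp add: lessThan_atLeast0 prod.atLeastLessThan_concat)
      also have "(\<Prod>i=length as..<length as + length bs. ((gs @ hs) ! i) ((as @ bs) ! i)) =
         (\<Prod>i<length bs. (hs ! i) (bs ! i))"
        by (rule prod.reindex_bij_witness[where i="\<lambda>i. i + length as" and j="\<lambda>i. i - length as"])
           (auto simp: nth_append *)
      also have "(\<Prod>i<length as. ((gs @ hs) ! i) ((as @ bs) ! i)) =
         (\<Prod>i<length as. (gs ! i) (as ! i))"
        by (rule prod.cong) (auto simp: nth_append *)
      finally show ?thesis .
    qed
    then show ?thesis using * by (auto simp: tprod_def pure_def)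
  qed
qed

lemma pure_split:
  assumes "length as = m + n"
  shows "pure scale (take m as) \<in> tensor_power scale m"
    and "pure scale (drop m as) \<in> tensor_power scale n"
    and "pure scale as = tprod m (pure scale (take m as)) (pure scale (drop m as))"
proof -
  have len: "length (take m as) = m" "length (drop m as) = n" using assms by auto
  show "pure scale (take m as) \<in> tensor_power scale m" "pure scale (drop m as) \<in> tensor_power scale n"
    using pure_in_tensor_power[of scale "take m as"] pure_in_tensor_power[of scale "drop m as"]
    unfolding len by auto
  show "pure scale as = tprod m (pure scale (take m as)) (pure scale (drop m as))"
    using pure_append[of "take m as" scale "drop m as"] unfolding len by simp
qed

lemma tprod_in_tensor_power:
  assumes "x \<in> tensor_power scale m" "y \<in> tensor_power scale n"
  shows "tprod m x y \<in> tensor_power scale (m + n)"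
  using assms(1)
proof (induction rule: tensor_power_induct)
  case zero
  have "tprod m 0 y = 0" by (simp add: tprod_def fun_eq_iff)
  then show "tprod m 0 y \<in> tensor_power scale (m + n)" by (simp add: tensor_power_zero)
next
  case (add c as z)
  have "tprod m (pure scale as) y \<in> tensor_power scale (m + n)"
    using assms(2)
  proof (induction rule: tensor_power_induct)
    case zero
    have "tprod m (pure scale as) 0 = 0" by (simp add: tprod_def fun_eq_iff)
    then show "tprod m (pure scale as) 0 \<in> tensor_power scale (m + n)" by (simp add: tensor_power_zero)
  next
    case (add d bs w)
    have "tprod m (pure scale as) (tscale d (pure scale bs) + w) =
        tscale d (pure scale (as @ bs)) + tprod m (pure scale as) w"
      using \<open>length as = m\<close>
      by (simp add: pure_append[symmetric] tprod_def tscale_def fun_eq_iff algebra_simps)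
    then show "tprod m (pure scale as) (tscale d (pure scale bs) + w) \<in> tensor_power scale (m + n)"
      using add \<open>length as = m\<close> pure_in_tensor_power[of scale "as @ bs"]
      by (simp add: tensor_power_add tensor_power_scale)
  qed
  moreover have "tprod m (tscale c (pure scale as) + z) y =
      tscale c (tprod m (pure scale as) y) + tprod m z y"
    by (simp add: tprod_def tscale_def fun_eq_iff algebra_simps)
  ultimately show "tprod m (tscale c (pure scale as) + z) y \<in> tensor_power scale (m + n)"
    using add by (simp add: tensor_power_add tensor_power_scale)
qed

lemma tensor_op_tprod:
  assumes "P \<in> tensor_End scale m" "Q \<in> tensor_End scale n"
    and x: "x \<in> tensor_power scale m" and y: "y \<in> tensor_power scale n"
  shows "tensor_op scale m n P Q (tprod m x y) = tprod m (P x) (Q y)"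
proof
  fix fs
  have slice: "Q (\<lambda>hs. tprod m x y (gs @ hs)) = tscale (x gs) (Q y)" for gs
  proof (cases "length gs = m")
    case True
    then have "(\<lambda>hs. tprod m x y (gs @ hs)) = tscale (x gs) y"
      by (simp add: tprod_def tscale_def fun_eq_iff)
    then show ?thesis using tensor_EndD(3)[OF assms(2) y] by simp
  next
    case gs: False
    have "Q (\<lambda>hs. tprod m x y (gs @ hs)) = 0"
    proof (cases "(\<lambda>hs. tprod m x y (gs @ hs)) \<in> tensor_power scale n")
      case True
      have "(\<lambda>hs. tprod m x y (gs @ hs)) = 0"
      proof
        fix hs
        show "tprod m x y (gs @ hs) = 0 hs"
        proof (cases "length hs = n")
          case True
          have "length (gs @ hs) \<noteq> m + n" using gs True by simp
          then show ?thesis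
            using tensor_power_length[OF tprod_in_tensor_power[OF x y]] by simp
        next
          case False
          then show ?thesis using tensor_power_length[OF True False] by simp
        qed
      qed
      then show ?thesis using tensor_End_zero[OF assms(2)] by simp
    next
      case False
      then show ?thesis using tensor_EndD(4)[OF assms(2)] by simp
    qed
    moreover have "x gs = 0" using tensor_power_length[OF x gs] .
    ultimately show ?thesis by (simp add: tscale_def fun_eq_iff)
  qed
  have "(\<lambda>gs. Q (\<lambda>hs. tprod m x y (gs @ hs)) (drop m fs)) = tscale (Q y (drop m fs)) x"
    by (simp add: slice tscale_def fun_eq_iff)
  then show "tensor_op scale m n P Q (tprod m x y) fs = tprod m (P x) (Q y) fs"
    using tprod_in_tensor_power[OF x y] tensor_EndD(3)[OF assms(1) x]
    by (simp add: tensor_op_def tprod_def tscale_def)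
qed

text \<open>Two operators agreeing on pure tensors are equal.\<close>

lemma tensor_End_eqI:
  assumes "R \<in> tensor_End scale n" "S \<in> tensor_End scale n"
    and "\<And>as. length as = n \<Longrightarrow> R (pure scale as) = S (pure scale as)"
  shows "R = S"
proof
  fix x
  show "R x = S x"
  proof (cases "x \<in> tensor_power scale n")
    case True
    then show ?thesis
    proof (induction rule: tensor_power_induct)
      case zero
      then show "R 0 = S 0" using assms(1,2) by (simp add: tensor_End_zero)
    next
      case (add c as y)
      then have "pure scale as \<in> tensor_power scale n"
        using pure_in_tensor_power[of scale as] by simp
      then show "R (tscale c (pure scale as) + y) = S (tscale c (pure scale as) + y)"
        using add assms by (simp add: tensor_EndD tensor_power_scale)
    qed
  next
    case False
    then show ?thesis using assms(1,2) by (simp add: tensor_EndD(4))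
  qed
qed

lemma tensor_op_End:
  assumes P: "P \<in> tensor_End scale m" and Q: "Q \<in> tensor_End scale n"
  shows "tensor_op scale m n P Q \<in> tensor_End scale (m + n)"
proof -
  let ?T = "tensor_power scale"
  have slice: "(\<lambda>hs. x (gs @ hs)) \<in> ?T n" if "x \<in> ?T (m + n)" "length gs = m" for x gs
    using that(1)
  proof (induction rule: tensor_power_induct)
    case zero
    have "(\<lambda>hs. 0 (gs @ hs)) = (0 :: ('b, 'a) tensor)" by (simp add: fun_eq_iff)
    then show "(\<lambda>hs. (0 :: ('b, 'a) tensor) (gs @ hs)) \<in> ?T n"
      by (rule ssubst) (rule tensor_power_zero)
  next
    case (add c as y)
    note split = pure_split[OF \<open>length as = m + n\<close>, of scale]
    have "(\<lambda>hs. (tscale c (pure scale as) + y) (gs @ hs)) =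
        tscale (c * pure scale (take m as) gs) (pure scale (drop m as)) + (\<lambda>hs. y (gs @ hs))"
      unfolding split(3) using \<open>length gs = m\<close> by (simp add: tprod_def tscale_def fun_eq_iff)
    then show "(\<lambda>hs. (tscale c (pure scale as) + y) (gs @ hs)) \<in> ?T n"
      using add split(2)
      by (simp add: tensor_power_add tensor_power_scale)
  qed
  have slice0: "Q (\<lambda>hs. x (gs @ hs)) = 0" if "x \<in> ?T (m + n)" "length gs \<noteq> m" for x gs
  proof (cases "(\<lambda>hs. x (gs @ hs)) \<in> ?T n")
    case True
    have "x (gs @ hs) = 0" for hs
      using tensor_power_length[OF True, of hs] tensor_power_length[OF that(1), of "gs @ hs"] that(2)
      by (cases "length hs = n") auto
    then have "(\<lambda>hs. x (gs @ hs)) = 0" by (simp add: fun_eq_iff)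
    then show ?thesis using tensor_End_zero[OF Q] by simp
  qed (simp add: tensor_EndD(4)[OF Q])
  have Qadd: "Q (\<lambda>hs. (x + y) (gs @ hs)) = Q (\<lambda>hs. x (gs @ hs)) + Q (\<lambda>hs. y (gs @ hs))"
    if "x \<in> ?T (m + n)" "y \<in> ?T (m + n)" for x y gs
  proof (cases "length gs = m")
    case True
    have "(\<lambda>hs. (x + y) (gs @ hs)) = (\<lambda>hs. x (gs @ hs)) + (\<lambda>hs. y (gs @ hs))"
      by (simp add: fun_eq_iff)
    then show ?thesis
      using tensor_EndD(2)[OF Q slice[OF that(1) True] slice[OF that(2) True]] by simp
  next
    case False
    then show ?thesis
      using slice0[OF that(1) False] slice0[OF that(2) False]
        slice0[OF tensor_power_add[OF that] False] by simp
  qed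
  have Qscale: "Q (\<lambda>hs. tscale c x (gs @ hs)) = tscale c (Q (\<lambda>hs. x (gs @ hs)))"
    if "x \<in> ?T (m + n)" for x c gs
  proof (cases "length gs = m")
    case True
    have "(\<lambda>hs. tscale c x (gs @ hs)) = tscale c (\<lambda>hs. x (gs @ hs))"
      by (simp add: fun_eq_iff tscale_def)
    then show ?thesis using tensor_EndD(3)[OF Q slice[OF that True]] by simp
  next
    case False
    then show ?thesis
      using slice0[OF that False] slice0[OF tensor_power_scale[OF that] False]
      by (simp add: tscale_def fun_eq_iff)
  qed
  have inner: "(\<lambda>gs. Q (\<lambda>hs. x (gs @ hs)) ks) \<in> ?T m" if "x \<in> ?T (m + n)" for x ks
    using that
  proof (induction rule: tensor_power_induct)
    case zero
    have eq: "(\<lambda>hs. 0 (gs @ hs)) = (0 :: ('b, 'a) tensor)" for gs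
      by (simp add: fun_eq_iff)
    have "Q (\<lambda>hs. 0 (gs @ hs)) = 0" for gs
      unfolding eq by (rule tensor_End_zero[OF Q])
    then have "(\<lambda>gs. Q (\<lambda>hs. 0 (gs @ hs)) ks) = 0"
      by (simp add: fun_eq_iff)
    then show "(\<lambda>gs. Q (\<lambda>hs. 0 (gs @ hs)) ks) \<in> ?T m"
      by (rule ssubst) (rule tensor_power_zero)
  next
    case (add c as y)
    let ?a = "pure scale (take m as)" and ?b = "pure scale (drop m as)"
    have a: "?a \<in> ?T m" and b: "?b \<in> ?T n" and ab: "pure scale as = tprod m ?a ?b"
      using pure_split[OF \<open>length as = m + n\<close>] by auto
    have as: "pure scale as \<in> ?T (m + n)"
      using pure_in_tensor_power[of scale as] add by simp
    have "Q (\<lambda>hs. pure scale as (gs @ hs)) = tscale (?a gs) (Q ?b)" for gs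
    proof (cases "length gs = m")
      case True
      then have "(\<lambda>hs. pure scale as (gs @ hs)) = tscale (?a gs) ?b"
        by (simp add: ab tprod_def tscale_def fun_eq_iff)
      then show ?thesis using tensor_EndD(3)[OF Q b] by simp
    next
      case False
      then show ?thesis
        using slice0[OF as False] tensor_power_length[OF a False]
        by (simp add: tscale_def fun_eq_iff)
    qed
    then have "(\<lambda>gs. Q (\<lambda>hs. (tscale c (pure scale as) + y) (gs @ hs)) ks) =
        tscale (c * Q ?b ks) ?a + (\<lambda>gs. Q (\<lambda>hs. y (gs @ hs)) ks)"
      using Qadd[OF tensor_power_scale[OF as] add(2)] Qscale[OF as]
      by (simp add: fun_eq_iff tscale_def)
    then show "(\<lambda>gs. Q (\<lambda>hs. (tscale c (pure scale as) + y) (gs @ hs)) ks) \<in> ?T m"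
      using add a by (simp add: tensor_power_add tensor_power_scale)
  qed
  have op_add: "tensor_op scale m n P Q (x + y) = tensor_op scale m n P Q x + tensor_op scale m n P Q y"
    if "x \<in> ?T (m + n)" "y \<in> ?T (m + n)" for x y
  proof
    fix fs
    have "(\<lambda>gs. Q (\<lambda>hs. (x + y) (gs @ hs)) (drop m fs)) =
      (\<lambda>gs. Q (\<lambda>hs. x (gs @ hs)) (drop m fs)) + (\<lambda>gs. Q (\<lambda>hs. y (gs @ hs)) (drop m fs))"
      using Qadd[OF that] by (simp add: fun_eq_iff)
    then show "tensor_op scale m n P Q (x + y) fs =
        (tensor_op scale m n P Q x + tensor_op scale m n P Q y) fs"
      using that tensor_EndD(2)[OF P inner[OF that(1)] inner[OF that(2)]]
      by (simp add: tensor_op_def tensor_power_add)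
  qed
  have op_scale: "tensor_op scale m n P Q (tscale c x) = tscale c (tensor_op scale m n P Q x)"
    if "x \<in> ?T (m + n)" for c x
  proof
    fix fs
    have "(\<lambda>gs. Q (\<lambda>hs. tscale c x (gs @ hs)) (drop m fs)) =
      tscale c (\<lambda>gs. Q (\<lambda>hs. x (gs @ hs)) (drop m fs))"
      using Qscale[OF that] by (simp add: fun_eq_iff tscale_def)
    then show "tensor_op scale m n P Q (tscale c x) fs = tscale c (tensor_op scale m n P Q x) fs"
      using that tensor_power_scale[OF that] tensor_EndD(3)[OF P inner[OF that]]
      by (simp add: tensor_op_def) (simp add: tscale_def)
  qed
  have mem: "tensor_op scale m n P Q x \<in> ?T (m + n)" if "x \<in> ?T (m + n)" for x
    using that
  proof (induction rule: tensor_power_induct)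
    case zero
    have "tensor_op scale m n P Q 0 = 0"
      using op_add[OF tensor_power_zero tensor_power_zero] by simp
    then show "tensor_op scale m n P Q 0 \<in> ?T (m + n)" by (simp add: tensor_power_zero)
  next
    case (add c as y)
    let ?a = "pure scale (take m as)" and ?b = "pure scale (drop m as)"
    have a: "?a \<in> ?T m" and b: "?b \<in> ?T n" and ab: "pure scale as = tprod m ?a ?b"
      using pure_split[OF \<open>length as = m + n\<close>] by auto
    have as: "pure scale as \<in> ?T (m + n)"
      using pure_in_tensor_power[of scale as] add by simp
    have "tensor_op scale m n P Q (pure scale as) = tprod m (P ?a) (Q ?b)"
      unfolding ab by (rule tensor_op_tprod[OF P Q a b])
    also have "\<dots> \<in> ?T (m + n)"
      using tprod_in_tensor_power tensor_EndD(1)[OF P a] tensor_EndD(1)[OF Q b] by blast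
    finally show "tensor_op scale m n P Q (tscale c (pure scale as) + y) \<in> ?T (m + n)"
      using add as
      by (simp add: op_add op_scale
          tensor_power_add tensor_power_scale)
  qed
  show ?thesis
    unfolding tensor_End_def using mem op_add op_scale by (auto simp: tensor_op_def)
qed

lemma tensor_op_unique:
  assumes "P \<in> tensor_End scale m" "Q \<in> tensor_End scale n"
  shows "\<exists>!R. R \<in> tensor_End scale (m + n) \<and>
    (\<forall>x\<in>tensor_power scale m. \<forall>y\<in>tensor_power scale n. R (tprod m x y) = tprod m (P x) (Q y))"
    and "tensor_op scale m n P Q = (THE R. R \<in> tensor_End scale (m + n) \<and>
    (\<forall>x\<in>tensor_power scale m. \<forall>y\<in>tensor_power scale n. R (tprod m x y) = tprod m (P x) (Q y)))"
proof -
  let ?C = "\<lambda>R. R \<in> tensor_End scale (m + n) \<and>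
    (\<forall>x\<in>tensor_power scale m. \<forall>y\<in>tensor_power scale n. R (tprod m x y) = tprod m (P x) (Q y))"
  have C: "?C (tensor_op scale m n P Q)"
    using tensor_op_End[OF assms] tensor_op_tprod[OF assms] by blast
  have unique: "R = tensor_op scale m n P Q" if "?C R" for R
  proof (rule tensor_End_eqI)
    fix as :: "'a list"
    assume "length as = m + n"
    then obtain x y where "x \<in> tensor_power scale m" "y \<in> tensor_power scale n"
      and xy: "pure scale as = tprod m x y"
      using pure_split[of as m n scale] by blast
    then show "R (pure scale as) = tensor_op scale m n P Q (pure scale as)"
      unfolding xy using that C by simp
  qed (use that C in auto)
  show "\<exists>!R. ?C R" by (rule ex1I[of ?C, OF C unique])
  show "tensor_op scale m n P Q = (THE R. ?C R)"
    by (rule the_equality[of ?C, OF C unique, symmetric])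
qed

lemma bij_sigma: "bij sigma"
proof (rule o_bij)
  define \<tau> :: "('k, 'v) tensor \<Rightarrow> ('k, 'v) tensor" where "\<tau> x = (\<lambda>fs. x (rev (rotate1 (rev fs))))" for x
  have *: "rotate1 (rev (rotate1 (rev fs))) = fs" "rev (rotate1 (rev (rotate1 fs))) = fs"
    for fs :: "('v \<Rightarrow> 'k) list"
  proof -
    show "rotate1 (rev (rotate1 (rev fs))) = fs" by (cases fs rule: rev_cases) simp_all
    show "rev (rotate1 (rev (rotate1 fs))) = fs" by (cases fs) simp_all
  qed
  show "\<tau> \<circ> sigma = id" "sigma \<circ> \<tau> = id"
    by (auto simp: \<tau>_def sigma_def fun_eq_iff *)
qed

lemma sigma_linear: "sigma (x + y) = sigma x + sigma y" "sigma (tscale c x) = tscale c (sigma x)"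
  by (auto simp: sigma_def tscale_def fun_eq_iff)

lemma sigma_pure: "sigma (pure scale (as @ [a])) = pure scale (a # as)"
proof
  fix fs
  show "sigma (pure scale (as @ [a])) fs = pure scale (a # as) fs"
  proof (cases fs)
    case Nil
    then show ?thesis by (simp add: sigma_def pure_def)
  next
    case (Cons f gs)
    have "(\<Prod>i<Suc (length as). ((gs @ [f]) ! i) ((as @ [a]) ! i)) =
          (\<Prod>i<Suc (length as). ((f # gs) ! i) ((a # as) ! i))" if "length gs = length as"
    proof -
      have "(\<Prod>i<Suc (length as). ((gs @ [f]) ! i) ((as @ [a]) ! i)) =
          (\<Prod>i<length as. (gs ! i) (as ! i)) * f a"
        using that by (simp add: nth_append)
      then show ?thesis unfolding prod.lessThan_Suc_shift by (simp add: mult.commute)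
    qed
    then show ?thesis unfolding Cons by (auto simp: sigma_def pure_def simp del: prod.lessThan_Suc)
  qed
qed

lemma bracket_L_pure:
  assumes "br \<in> tensor_End scale 2"
  shows "bracket_L scale br a (pure scale [b, c]) = tprod 2 (br (pure scale [a, b])) (pure scale [c])"
proof -
  have in2: "pure scale [a, b] \<in> tensor_power scale 2" and in1: "pure scale [c] \<in> tensor_power scale 1"
    using pure_in_tensor_power[of scale "[a, b]"] pure_in_tensor_power[of scale "[c]"]
    by (simp_all add: eval_nat_numeral)
  have "tprod 1 (pure scale [a]) (pure scale [b, c]) = tprod 2 (pure scale [a, b]) (pure scale [c])"
    using pure_append[of "[a]" scale "[b, c]"] pure_append[of "[a, b]" scale "[c]"]
    by (simp add: eval_nat_numeral)
  then show ?thesis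
    using tensor_op_tprod[OF assms tensor_id_End in2 in1] in1
    by (simp add: bracket_L_def tensor_id_def)
qed

text \<open>The universal property of \<open>V\<^sup>\<otimes>\<^sup>n\<close> for finite-dimensional \<open>V\<close>.\<close>

definition multilinear ::
    "('k::field \<Rightarrow> 'v::ab_group_add \<Rightarrow> 'v) \<Rightarrow> ('k \<Rightarrow> 'w::ab_group_add \<Rightarrow> 'w) \<Rightarrow> nat
      \<Rightarrow> ('v list \<Rightarrow> 'w) \<Rightarrow> bool" where
  "multilinear scale scale' n \<phi> \<longleftrightarrow> (\<forall>as bs. length as + length bs + 1 = n \<longrightarrow>
     Vector_Spaces.linear scale scale' (\<lambda>v. \<phi> (as @ v # bs)))"

lemma pure_multilinear:
  assumes "vector_space scale"
  shows "multilinear scale tscale n (pure scale)"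
  unfolding multilinear_def
proof (intro allI impI)
  fix as bs
  have split: "pure scale (as @ v # bs) =
      tprod (length as) (pure scale as) (tprod 1 (pure scale [v]) (pure scale bs))" for v
    using pure_append[of as scale "[v] @ bs"] pure_append[of "[v]" scale bs] by simp
  have lin: "f (u + v) = f u + f v" "f (scale c u) = c * f u"
    if "Vector_Spaces.linear scale (*) f" for f :: "'b \<Rightarrow> 'a" and u v c
  proof -
    interpret Vector_Spaces.linear scale "(*)" f by fact
    show "f (u + v) = f u + f v" "f (scale c u) = c * f u" by (simp_all add: add scale)
  qed
  have "pure scale [u + v] = pure scale [u] + pure scale [v]"
    "pure scale [scale c u] = tscale c (pure scale [u])" for u v c
    by (auto simp: pure_def tscale_def fun_eq_iff lin)
  then show "Vector_Spaces.linear scale tscale (\<lambda>v. pure scale (as @ v # bs))"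
    using assms vector_space_tscale
    by (simp add: Vector_Spaces.linear_iff split)
       (simp add: tprod_def tscale_def fun_eq_iff algebra_simps)
qed

theorem tensor_power_universal:
  fixes scale :: "'k::field \<Rightarrow> 'v::ab_group_add \<Rightarrow> 'v"
    and scale' :: "'k \<Rightarrow> 'w::ab_group_add \<Rightarrow> 'w"
  assumes V: "finite_dimensional_vector_space scale Basis" and W: "vector_space scale'"
    and \<phi>: "multilinear scale scale' n \<phi>"
  obtains L where "\<And>x y. L (x + y) = L x + L y" "\<And>c x. L (tscale c x) = scale' c (L x)"
    and "\<And>as. length as = n \<Longrightarrow> L (pure scale as) = \<phi> as"
    and "\<And>L' x. (\<And>x y. x \<in> tensor_power scale n \<Longrightarrow> y \<in> tensor_power scale n \<Longrightarrow> L' (x + y) = L' x + L' y)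
       \<Longrightarrow> (\<And>c x. x \<in> tensor_power scale n \<Longrightarrow> L' (tscale c x) = scale' c (L' x))
       \<Longrightarrow> (\<And>as. length as = n \<Longrightarrow> L' (pure scale as) = \<phi> as)
       \<Longrightarrow> x \<in> tensor_power scale n \<Longrightarrow> L' x = L x"
proof -
  interpret V: finite_dimensional_vector_space scale Basis by fact
  interpret W: vector_space scale' by fact
  define \<xi> where "\<xi> b v = V.representation Basis v b" for b v
  have \<xi>_linear: "Vector_Spaces.linear scale (*) (\<xi> b)" for b
    unfolding \<xi>_def by (rule V.linear_representation[OF V.independent_Basis V.span_Basis])
  have expand: "v = (\<Sum>b\<in>Basis. scale (\<xi> b v) b)" for v
    unfolding \<xi>_def
    by (rule V.sum_representation_eq[symmetric])
       (auto simp: V.independent_Basis V.span_Basis V.finite_Basis)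
  define B where "B m = {bs. set bs \<subseteq> Basis \<and> length bs = m}" for m
  have finB: "finite (B m)" for m
    unfolding B_def by (rule finite_lists_length_eq[OF V.finite_Basis])
  define L where "L x = (\<Sum>bs\<in>B n. scale' (x (map \<xi> bs)) (\<phi> bs))" for x :: "('k, 'v) tensor"
  have pure_Nil: "pure scale [] [] = 1" by (simp add: pure_def)
  have pure_Cons: "pure scale (a # as) (map \<xi> (b # bs)) = \<xi> b a * pure scale as (map \<xi> bs)" for a as b bs
    using \<xi>_linear by (auto simp: pure_def prod.lessThan_Suc_shift simp del: prod.lessThan_Suc)
  have main: "\<phi> (cs @ as) = (\<Sum>bs\<in>B (length as). scale' (pure scale as (map \<xi> bs)) (\<phi> (cs @ bs)))"
    if "length cs + length as = n" for cs as
    using that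
  proof (induction as arbitrary: cs)
    case Nil
    have "B 0 = {[]}" by (auto simp: B_def)
    then show ?case by (simp add: pure_Nil)
  next
    case (Cons a as)
    have B_Suc: "B (Suc m) = (\<lambda>p. fst p # snd p) ` (Basis \<times> B m)" for m
      by (auto simp: B_def length_Suc_conv image_iff)
    have inj: "inj_on (\<lambda>p. fst p # snd p) (Basis \<times> B m)" for m
      by (auto simp: inj_on_def)
    interpret l: Vector_Spaces.linear scale scale' "\<lambda>v. \<phi> (cs @ v # as)"
      using \<phi> Cons.prems by (simp add: multilinear_def)
    have "\<phi> (cs @ a # as) = (\<Sum>b\<in>Basis. scale' (\<xi> b a) (\<phi> (cs @ b # as)))"
      by (subst (1) expand[of a]) (simp add: l.sum l.scale)
    also have "\<dots> = (\<Sum>b\<in>Basis. \<Sum>bs\<in>B (length as).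
        scale' (pure scale (a # as) (map \<xi> (b # bs))) (\<phi> (cs @ b # bs)))"
    proof (rule sum.cong[OF refl])
      fix b
      have "\<phi> (cs @ b # as) =
          (\<Sum>bs\<in>B (length as). scale' (pure scale as (map \<xi> bs)) (\<phi> (cs @ b # bs)))"
        using Cons.IH[of "cs @ [b]"] Cons.prems by simp
      then show "scale' (\<xi> b a) (\<phi> (cs @ b # as)) = (\<Sum>bs\<in>B (length as).
        scale' (pure scale (a # as) (map \<xi> (b # bs))) (\<phi> (cs @ b # bs)))"
        unfolding pure_Cons by (simp add: W.scale_sum_right)
    qed
    also have "\<dots> = (\<Sum>bs\<in>B (length (a # as)).
        scale' (pure scale (a # as) (map \<xi> bs)) (\<phi> (cs @ bs)))"
      by (simp add: B_Suc sum.reindex[OF inj] sum.cartesian_product case_prod_beta comp_def)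
    finally show ?case .
  qed
  have L_add: "L (x + y) = L x + L y" for x y
    by (simp add: L_def W.scale_left_distrib sum.distrib)
  have L_scale: "L (tscale c x) = scale' c (L x)" for c x
    by (simp add: L_def tscale_def W.scale_sum_right)
  have L_pure: "L (pure scale as) = \<phi> as" if "length as = n" for as
    using main[of "[]" as] that by (simp add: L_def)
  show ?thesis
  proof (rule that[OF L_add L_scale L_pure])
    fix L' x
    assume L'_add: "\<And>x y. x \<in> tensor_power scale n \<Longrightarrow> y \<in> tensor_power scale n \<Longrightarrow> L' (x + y) = L' x + L' y"
      and L'_scale: "\<And>c x. x \<in> tensor_power scale n \<Longrightarrow> L' (tscale c x) = scale' c (L' x)"
      and L'_pure: "\<And>as. length as = n \<Longrightarrow> L' (pure scale as) = \<phi> as"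
      and "x \<in> tensor_power scale n"
    from this(4) show "L' x = L x"
    proof (induction rule: tensor_power_induct)
      case zero
      then show "L' 0 = L 0"
        using L'_add[OF tensor_power_zero tensor_power_zero] L_add[of 0 0] by simp
    next
      case (add c as y)
      then have "pure scale as \<in> tensor_power scale n"
        using pure_in_tensor_power[of scale as] by simp
      then show "L' (tscale c (pure scale as) + y) = L (tscale c (pure scale as) + y)"
        using add by (simp add: L'_add L'_scale L'_pure L_add L_scale L_pure tensor_power_scale)
    qed
  qed
qed

end

theory Submission
  imports Defs
begin

text \<open>
  The bijection is the identity: a double Lie bracket and a Maurer-Cartan element of degree 1 are the
  same operator on \<open>V \<otimes> V\<close>, and the two axioms of a double Lie bracket are the two conditions on a
  Maurer-Cartan element, read on pure tensors.

  Since \<open>\<sigma>\<^sup>-\<^sup>1 (a \<otimes> b) = b \<otimes> a\<close>, skew-symmetry is the equation \<open>\<sigma> \<mu> \<sigma>\<^sup>-\<^sup>1 = -\<mu>\<close> on \<open>a \<otimes> b\<close>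
  (\<open>C_dL_1_iff_skew\<close>). For the Jacobi identity, \<open>(\<mu> \<diamond> \<mu>) (a \<otimes> b \<otimes> c) = {{a, {{b, c}}}}\<^sub>L\<close>, and
  \<open>\<sigma>\<^sup>-\<^sup>s\<close> permutes \<open>a, b, c\<close> cyclically, so the three summands of \<open>\<mu> \<square> \<mu>\<close>, whose signs are all \<open>+1\<close>
  as \<open>p + q = 2\<close>, are the three summands of the Jacobi identity (\<open>square_dL_1_1_pure\<close>).
  Finally \<open>[\<mu>, \<mu>] = \<mu> \<square> \<mu> - (-1) \<mu> \<square> \<mu> = 2 (\<mu> \<square> \<mu>)\<close>, and 2 is invertible
  (\<open>maurer_cartan_dL_iff_square\<close>).

  Equations between operators may be checked on pure tensors only once both sides are known to be
  endomorphisms of the same tensor power. For \<open>\<sigma> \<mu> \<sigma>\<^sup>-\<^sup>1\<close> and \<open>\<mu> \<square> \<mu>\<close> this rests on the fact that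
  \<open>\<sigma>\<close> maps \<open>V\<^sup>\<otimes>\<^sup>n\<close> and its complement to themselves (\<open>sigma_conj_End\<close>).
\<close>

section \<open>The cyclic permutation\<close>

lemma inv_sigma_sigma [simp]: "inv sigma (sigma x) = x"
  by (rule inv_f_f[OF bij_is_inj[OF bij_sigma]])

lemma sigma_inv_sigma [simp]: "sigma (inv sigma x) = x"
  by (rule surj_f_inv_f[OF bij_is_surj[OF bij_sigma]])

lemma inv_sigma_linear:
  "inv sigma (x + y) = inv sigma x + inv sigma y" "inv sigma (tscale c x) = tscale c (inv sigma x)"
proof -
  show "inv sigma (x + y) = inv sigma x + inv sigma y"
    using inv_sigma_sigma[of "inv sigma x + inv sigma y"] by (simp add: sigma_linear(1))
  show "inv sigma (tscale c x) = tscale c (inv sigma x)"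
    using inv_sigma_sigma[of "tscale c (inv sigma x)"] by (simp add: sigma_linear(2))
qed

lemma inv_sigma_pure: "inv sigma (pure scale (a # as)) = pure scale (as @ [a])"
  using inv_sigma_sigma[of "pure scale (as @ [a])"] by (simp add: sigma_pure)

lemma sigma_zero: "sigma 0 = 0"
  by (simp add: sigma_def fun_eq_iff)

lemma inv_sigma_zero: "inv sigma 0 = 0"
  using inv_sigma_sigma[of 0] by (simp add: sigma_zero)

lemma sigma_in_tensor_power:
  assumes "x \<in> tensor_power scale n"
  shows "sigma x \<in> tensor_power scale n"
  using assms
proof (induction rule: tensor_power_induct)
  case zero
  show "sigma 0 \<in> tensor_power scale n"
    by (simp add: sigma_zero tensor_power_zero)
next
  case (add c as y)
  have "sigma (pure scale as) \<in> tensor_power scale n"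
  proof (cases as rule: rev_cases)
    case Nil
    then have "sigma (pure scale as) = pure scale as"
      by (simp add: sigma_def pure_def fun_eq_iff)
    then show ?thesis
      using pure_in_tensor_power[of scale as] add by simp
  next
    case (snoc bs b)
    then show ?thesis
      using pure_in_tensor_power[of scale "b # bs"] add by (simp add: sigma_pure)
  qed
  then show "sigma (tscale c (pure scale as) + y) \<in> tensor_power scale n"
    using add by (simp add: sigma_linear tensor_power_add tensor_power_scale)
qed

lemma inv_sigma_in_tensor_power:
  assumes "x \<in> tensor_power scale n"
  shows "inv sigma x \<in> tensor_power scale n"
  using assms
proof (induction rule: tensor_power_induct)
  case zero
  show "inv sigma 0 \<in> tensor_power scale n"
    by (simp add: inv_sigma_zero tensor_power_zero)
next
  case (add c as y)
  have "inv sigma (pure scale as) \<in> tensor_power scale n"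
  proof (cases as)
    case Nil
    then have "sigma (pure scale as) = pure scale as"
      by (simp add: sigma_def pure_def fun_eq_iff)
    then have "inv sigma (pure scale as) = pure scale as"
      by (metis inv_sigma_sigma)
    then show ?thesis
      using pure_in_tensor_power[of scale as] add by simp
  next
    case (Cons b bs)
    then show ?thesis
      using pure_in_tensor_power[of scale "bs @ [b]"] add by (simp add: inv_sigma_pure)
  qed
  then show "inv sigma (tscale c (pure scale as) + y) \<in> tensor_power scale n"
    using add by (simp add: inv_sigma_linear tensor_power_add tensor_power_scale)
qed

text \<open>
  Elements of \<open>tensor_End\<close> vanish outside \<open>V\<^sup>\<otimes>\<^sup>n\<close>; conjugation keeps this because \<open>\<sigma>\<close>, a bijection of
  the whole tensor type, preserves \<open>V\<^sup>\<otimes>\<^sup>n\<close> and its complement.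
\<close>

lemma sigma_conj_End:
  assumes P: "P \<in> tensor_End scale n"
  shows "sigma \<circ> P \<circ> inv sigma \<in> tensor_End scale n"
proof -
  have "(sigma \<circ> P \<circ> inv sigma) x = 0" if "x \<notin> tensor_power scale n" for x
  proof -
    have "inv sigma x \<notin> tensor_power scale n"
      using sigma_in_tensor_power[of "inv sigma x" scale n] that by auto
    then show ?thesis
      using tensor_EndD(4)[OF P] by (simp add: sigma_zero)
  qed
  then show ?thesis
    using P unfolding tensor_End_def[of scale n]
    by (auto simp: sigma_in_tensor_power inv_sigma_in_tensor_power sigma_linear inv_sigma_linear
        tensor_EndD)
qed

lemma sigma_conj_funpow_End:
  assumes "P \<in> tensor_End scale n"
  shows "(sigma ^^ s) \<circ> P \<circ> (inv sigma ^^ s) \<in> tensor_End scale n"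
proof (induction s)
  case 0
  show ?case using assms by simp
next
  case (Suc s)
  have "(sigma ^^ Suc s) \<circ> P \<circ> (inv sigma ^^ Suc s) =
      sigma \<circ> ((sigma ^^ s) \<circ> P \<circ> (inv sigma ^^ s)) \<circ> inv sigma"
    by (simp only: funpow.simps(2)[of s sigma] funpow_Suc_right[of s "inv sigma"] o_assoc)
  then show ?case
    using sigma_conj_End[OF Suc] by (simp only:)
qed

section \<open>Closure properties of endomorphisms\<close>

lemma zero_End: "0 \<in> tensor_End scale n"
  by (auto simp: tensor_End_def tensor_power_zero tscale_def fun_eq_iff)

lemma add_End:
  assumes "P \<in> tensor_End scale n" "Q \<in> tensor_End scale n"
  shows "P + Q \<in> tensor_End scale n"
  using tensor_EndD[OF assms(1)] tensor_EndD[OF assms(2)]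
  unfolding tensor_End_def
  by (auto simp: tensor_power_add tscale_def fun_eq_iff algebra_simps)

lemma oscale_End:
  assumes "P \<in> tensor_End scale n"
  shows "oscale c P \<in> tensor_End scale n"
  using tensor_EndD[OF assms] unfolding tensor_End_def
  by (auto simp: oscale_def tensor_power_scale) (auto simp: tscale_def fun_eq_iff algebra_simps)

lemma sum_End:
  assumes "\<And>i. i \<in> I \<Longrightarrow> P i \<in> tensor_End scale n"
  shows "(\<Sum>i\<in>I. P i) \<in> tensor_End scale n"
  using assms by (induction I rule: infinite_finite_induct) (auto simp: zero_End add_End)

lemma comp_End:
  assumes "P \<in> tensor_End scale n" "Q \<in> tensor_End scale n"
  shows "P \<circ> Q \<in> tensor_End scale n"
  using assms tensor_End_zero[OF assms(1)] unfolding tensor_End_def[of scale n]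
  by auto

lemma diamond_End:
  assumes "P \<in> tensor_End scale (p + 1)" "Q \<in> tensor_End scale (q + 1)"
  shows "diamond scale p q P Q \<in> tensor_End scale (p + q + 1)"
  using tensor_op_End[OF assms(1) tensor_id_End[of scale q]]
    tensor_op_End[OF tensor_id_End[of scale p] assms(2)]
  unfolding diamond_def by (simp add: comp_End)

lemma square_dL_End:
  assumes "P \<in> tensor_End scale (p + 1)" "Q \<in> tensor_End scale (q + 1)"
  shows "square_dL scale p q P Q \<in> tensor_End scale (p + q + 1)"
  unfolding square_dL_def
  by (intro sum_End oscale_End sigma_conj_funpow_End diamond_End assms)

section \<open>Maurer-Cartan elements of degree 1\<close>

text \<open>
  In degree 1 the equivariance condition is \<open>\<sigma> \<mu> \<sigma>\<^sup>-\<^sup>1 = -\<mu>\<close>, and \<open>\<sigma>\<^sup>-\<^sup>1\<close> swaps the two factors of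
  \<open>a \<otimes> b\<close>.
\<close>

lemma C_dL_1_iff_skew:
  fixes scale :: "'k::field \<Rightarrow> 'v::ab_group_add \<Rightarrow> 'v"
  shows "\<mu> \<in> C_dL scale 1 \<longleftrightarrow> \<mu> \<in> tensor_End scale 2 \<and>
     (\<forall>a b. \<mu> (pure scale [a, b]) = - sigma (\<mu> (pure scale [b, a])))"
proof (cases "\<mu> \<in> tensor_End scale 2")
  case True
  have "sigma \<circ> \<mu> \<circ> inv sigma = oscale (- 1) \<mu> \<longleftrightarrow>
      (\<forall>a b. (sigma \<circ> \<mu> \<circ> inv sigma) (pure scale [a, b]) = oscale (- 1) \<mu> (pure scale [a, b]))"
  proof
    assume R: "\<forall>a b. (sigma \<circ> \<mu> \<circ> inv sigma) (pure scale [a, b]) = oscale (- 1) \<mu> (pure scale [a, b])"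
    show "sigma \<circ> \<mu> \<circ> inv sigma = oscale (- 1) \<mu>"
    proof (rule tensor_End_eqI[OF sigma_conj_End[OF True] oscale_End[OF True]])
      fix as :: "'v list"
      assume "length as = 2"
      then obtain a b where "as = [a, b]" by (auto simp: length_Suc_conv eval_nat_numeral)
      then show "(sigma \<circ> \<mu> \<circ> inv sigma) (pure scale as) = oscale (- 1) \<mu> (pure scale as)"
        using R by blast
    qed
  qed simp
  moreover have "(sigma \<circ> \<mu> \<circ> inv sigma) (pure scale [a, b]) = oscale (- 1) \<mu> (pure scale [a, b])
      \<longleftrightarrow> \<mu> (pure scale [a, b]) = - sigma (\<mu> (pure scale [b, a]))" for a b
  proof -
    have "oscale (- 1) \<mu> x = - \<mu> x" for x
      by (simp add: oscale_def tscale_def fun_eq_iff)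
    then show ?thesis
      using inv_sigma_pure[of scale a "[b]"] by (auto simp: minus_equation_iff[of "sigma _"])
  qed
  ultimately show ?thesis
    using True by (simp add: C_dL_def flip: one_add_one)
qed (simp add: C_dL_def flip: one_add_one)

text \<open>
  \<open>id \<otimes> Q\<close> leaves \<open>a\<close> in front of \<open>Q (b \<otimes> c)\<close>, and \<open>P \<otimes> id\<close> applied to a tensor beginning with
  \<open>a\<close> is by definition the left extension of \<open>P\<close>.
\<close>

lemma diamond_1_1_pure:
  assumes P: "P \<in> tensor_End scale 2" and Q: "Q \<in> tensor_End scale 2"
  shows "diamond scale 1 1 P Q (pure scale [a, b, c]) = bracket_L scale P a (Q (pure scale [b, c]))"
proof -
  have a: "pure scale [a] \<in> tensor_power scale 1" and bc: "pure scale [b, c] \<in> tensor_power scale 2"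
    using pure_in_tensor_power[of scale "[a]"] pure_in_tensor_power[of scale "[b, c]"]
    by (simp_all add: eval_nat_numeral)
  have "pure scale [a, b, c] = tprod 1 (pure scale [a]) (pure scale [b, c])"
    using pure_append[of "[a]" scale "[b, c]"] by simp
  then have "tensor_op scale 1 2 (tensor_id scale 1) Q (pure scale [a, b, c]) =
      tprod 1 (pure scale [a]) (Q (pure scale [b, c]))"
    using tensor_op_tprod[OF tensor_id_End Q a bc] a by (simp add: tensor_id_def)
  then show ?thesis
    by (simp add: diamond_def bracket_L_def flip: one_add_one)
qed

text \<open>
  The signs \<open>(-1)\<^sup>2\<^sup>s\<close> are trivial, and \<open>\<sigma>\<^sup>-\<^sup>s\<close> takes \<open>a \<otimes> b \<otimes> c\<close> to \<open>b \<otimes> c \<otimes> a\<close> for \<open>s = 1\<close> and to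
  \<open>c \<otimes> a \<otimes> b\<close> for \<open>s = 2\<close>: the order in which the three vectors enter the Jacobi identity.
\<close>

lemma square_dL_1_1_pure:
  fixes scale :: "'k::field \<Rightarrow> 'v::ab_group_add \<Rightarrow> 'v"
  assumes "P \<in> tensor_End scale 2" "Q \<in> tensor_End scale 2"
  shows "square_dL scale 1 1 P Q (pure scale [a, b, c]) =
    bracket_L scale P a (Q (pure scale [b, c])) +
    sigma (bracket_L scale P b (Q (pure scale [c, a]))) +
    (sigma ^^ 2) (bracket_L scale P c (Q (pure scale [a, b])))"
proof -
  have range: "{0..1 + 1::nat} = {0, 1, 2}" by auto
  have one: "oscale 1 R = R" for R :: "('k, 'v) operator"
    by (simp add: oscale_def tscale_def)
  have inv2: "(inv sigma ^^ 2) (pure scale [a, b, c]) = pure scale [c, a, b]"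
    using inv_sigma_pure[of scale a "[b, c]"] inv_sigma_pure[of scale b "[c, a]"]
    by (simp add: eval_nat_numeral)
  have inv1: "inv sigma (pure scale [a, b, c]) = pure scale [b, c, a]"
    using inv_sigma_pure[of scale a "[b, c]"] by simp
  have "square_dL scale 1 1 P Q =
      diamond scale 1 1 P Q + (sigma \<circ> diamond scale 1 1 P Q \<circ> inv sigma) +
      ((sigma ^^ 2) \<circ> diamond scale 1 1 P Q \<circ> (inv sigma ^^ 2))"
    unfolding square_dL_def range by (simp add: one add.assoc)
  then show ?thesis
    by (simp add: inv1 inv2 diamond_1_1_pure[OF assms] del: One_nat_def)
qed

lemma square_dL_zero_iff_jacobi:
  fixes scale :: "'k::field \<Rightarrow> 'v::ab_group_add \<Rightarrow> 'v"
  assumes \<mu>: "\<mu> \<in> tensor_End scale 2"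
  shows "square_dL scale 1 1 \<mu> \<mu> = 0 \<longleftrightarrow>
    (\<forall>a b c.
        bracket_L scale \<mu> a (\<mu> (pure scale [b, c])) +
        sigma (bracket_L scale \<mu> b (\<mu> (pure scale [c, a]))) +
        (sigma ^^ 2) (bracket_L scale \<mu> c (\<mu> (pure scale [a, b]))) = 0)"
    (is "?S = 0 \<longleftrightarrow> ?J")
proof
  assume J: ?J
  have S: "?S \<in> tensor_End scale 3"
    using square_dL_End[of \<mu> scale 1 \<mu> 1] \<mu> by (simp add: eval_nat_numeral)
  show "?S = 0"
  proof (rule tensor_End_eqI[OF S zero_End])
    fix as :: "'v list"
    assume "length as = 3"
    then obtain a b c where "as = [a, b, c]" by (auto simp: length_Suc_conv eval_nat_numeral)
    then show "?S (pure scale as) = 0 (pure scale as)"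
      using J by (simp add: square_dL_1_1_pure[OF \<mu> \<mu>] del: One_nat_def)
  qed
next
  assume "?S = 0"
  then show ?J
    by (simp flip: square_dL_1_1_pure[OF \<mu> \<mu>])
qed

text \<open>
  In odd degree the sign \<open>-(-1)\<^sup>1\<close> is \<open>+1\<close>, so the self-bracket does not cancel but doubles.
\<close>

lemma bracket_dL_1_1_self: "bracket_dL scale 1 1 \<mu> \<mu> = oscale 2 (square_dL scale 1 1 \<mu> \<mu>)"
  by (simp add: bracket_dL_def oscale_def tscale_def fun_eq_iff)

lemma oscale_eq_0_iff: "oscale c P = 0 \<longleftrightarrow> c = 0 \<or> P = 0"
  by (auto simp: oscale_def tscale_def fun_eq_iff)

lemma maurer_cartan_dL_iff_bracket:
  fixes scale :: "'k::field_char_0 \<Rightarrow> 'v::ab_group_add \<Rightarrow> 'v"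
  shows "maurer_cartan_dL scale \<mu> \<longleftrightarrow> \<mu> \<in> C_dL scale 1 \<and> bracket_dL scale 1 1 \<mu> \<mu> = 0"
  by (simp add: maurer_cartan_dL_def maurer_cartan_def oscale_eq_0_iff)

lemma maurer_cartan_dL_iff_square:
  fixes scale :: "'k::field_char_0 \<Rightarrow> 'v::ab_group_add \<Rightarrow> 'v"
  shows "maurer_cartan_dL scale \<mu> \<longleftrightarrow> \<mu> \<in> C_dL scale 1 \<and> square_dL scale 1 1 \<mu> \<mu> = 0"
  unfolding maurer_cartan_dL_iff_bracket bracket_dL_1_1_self oscale_eq_0_iff by simp

lemma maurer_cartan_dL_iff_double_lie_bracket:
  fixes scale :: "'k::field_char_0 \<Rightarrow> 'v::ab_group_add \<Rightarrow> 'v"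
  shows "maurer_cartan_dL scale \<mu> \<longleftrightarrow> double_lie_bracket scale \<mu>"
  unfolding maurer_cartan_dL_iff_square double_lie_bracket_def C_dL_1_iff_skew
  using square_dL_zero_iff_jacobi by blast

theorem corollary2p7:
  fixes scale :: "'k::field_char_0 \<Rightarrow> 'v::ab_group_add \<Rightarrow> 'v"
    and Basis :: "'v set"
  assumes "finite_dimensional_vector_space scale Basis"
  shows "(\<exists>\<Phi>. bij_betw \<Phi> {\<mu>. maurer_cartan_dL scale \<mu>} {br. double_lie_bracket scale br} \<and>
           (\<forall>\<mu>. maurer_cartan_dL scale \<mu> \<longrightarrow>
              (\<forall>a b. \<Phi> \<mu> (pure scale [a, b]) = \<mu> (pure scale [a, b])))) \<and>
         (\<forall>\<mu>\<in>C_dL scale 1. maurer_cartan_dL scale \<mu> \<longleftrightarrow> bracket_dL scale 1 1 \<mu> \<mu> = 0)"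
proof
  show "\<exists>\<Phi>. bij_betw \<Phi> {\<mu>. maurer_cartan_dL scale \<mu>} {br. double_lie_bracket scale br} \<and>
      (\<forall>\<mu>. maurer_cartan_dL scale \<mu> \<longrightarrow>
         (\<forall>a b. \<Phi> \<mu> (pure scale [a, b]) = \<mu> (pure scale [a, b])))"
    by (rule exI[of _ id]) (simp add: maurer_cartan_dL_iff_double_lie_bracket)
  show "\<forall>\<mu>\<in>C_dL scale 1. maurer_cartan_dL scale \<mu> \<longleftrightarrow> bracket_dL scale 1 1 \<mu> \<mu> = 0"
    by (simp add: maurer_cartan_dL_iff_bracket)
qed

end
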